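(* Let $U$ be a unicyclic graph and let $\tau$ be a 2-switch on $U$ that removes two disjoint edges $e_1,e_2$ of $U$. Then: (1) If $e_1,e_2\in E(\operatorname{For}(U))$, then $\tau(U)$ is unicyclic if and only if, for every $e\in E(\operatorname{Cyc}(U))$, $\tau$ (viewed as a 2-switch on the tree $U-e$) is a t-switch on $U-e$. (2) If $e_1\in E(\operatorname{Cyc}(U))$ and $e_2\in E(\operatorname{For}(U))$, then $\tau(U)$ is unicyclic. (3) If $e_1,e_2\in E(\operatorname{Cyc}(U))$, then $\tau(U)$ is unicyclic if and only if $\tau(\operatorname{Cyc}(U))$ is isomorphic to $\operatorname{Cyc}(U)$.
   Context: Graphs are finite and simple. A unicyclic graph is a connected graph with exactly one cycle. A 2-switch on $G$ is specified by four distinct vertices $a,b,c,d$ with $ab,cd\in E(G)$ and $ac,bd\notin E(G)$; it produces $\tau(G)=G-ab-cd+ac+bd$, and we say it removes $ab$ and $cd$. For a graph $G$, $\operatorname{Cyc}(G)$ is the subgraph of $G$ induced by all vertices lying on some cycle of $G$, and $\operatorname{For}(G)=G-E(\operatorname{Cyc}(G))$. A 2-switch $\tau$ on a tree $T$ is a t-switch if $\tau(T)$ is a tree. *)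

theory Defs
  imports "Graph_Theory.Graph_Theory"
begin

text \<open>
  Finite simple graphs are the library's \<^const>\<open>pair_graph\<close>s: every undirected edge
  \<open>uv\<close> is represented by the two arcs \<open>(u, v)\<close> and \<open>(v, u)\<close>. The library's
  \<^const>\<open>pre_digraph.cycle\<close> is a directed notion, under which \<open>[(u, v), (v, u)]\<close> is a
  cycle, so its \<^const>\<open>forest\<close> and \<^const>\<open>tree\<close> are unsuitable for symmetric digraphs.
  Undirected cycles are those of length at least 3, and two cycles are identified when
  they form the same subgraph, i.e. regardless of starting point and orientation.
\<close>

definition edges :: "'a pair_pre_digraph \<Rightarrow> 'a set set" where
  "edges G = (\<lambda>(u, v). {u, v}) ` parcs G"

definition del_edges :: "'a pair_pre_digraph \<Rightarrow> 'a set set \<Rightarrow> 'a pair_pre_digraph" where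
  "del_edges G F = G\<lparr>parcs := {(u, v) \<in> parcs G. {u, v} \<notin> F}\<rparr>"

definition add_edges :: "'a pair_pre_digraph \<Rightarrow> 'a set set \<Rightarrow> 'a pair_pre_digraph" where
  "add_edges G F = G\<lparr>parcs := parcs G \<union> {(u, v). {u, v} \<in> F}\<rparr>"

definition walk_subgraph :: "('a \<times> 'a) awalk \<Rightarrow> 'a pair_pre_digraph" where
  "walk_subgraph p = \<lparr>pverts = fst ` set p \<union> snd ` set p, parcs = set p \<union> (set p)\<inverse>\<rparr>"

definition cycle_subgraphs :: "'a pair_pre_digraph \<Rightarrow> 'a pair_pre_digraph set" where
  "cycle_subgraphs G =
    {walk_subgraph p | p. pre_digraph.cycle (with_proj G) p \<and> 3 \<le> length p}"

definition unicyclic :: "'a pair_pre_digraph \<Rightarrow> bool" where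
  "unicyclic G \<longleftrightarrow>
    pair_graph G \<and> connected (with_proj G) \<and> (\<exists>!C. C \<in> cycle_subgraphs G)"

definition undirected_tree :: "'a pair_pre_digraph \<Rightarrow> bool" where
  "undirected_tree G \<longleftrightarrow>
    pair_graph G \<and> connected (with_proj G) \<and> cycle_subgraphs G = {}"

definition Cyc :: "'a pair_pre_digraph \<Rightarrow> 'a pair_pre_digraph" where
  "Cyc G = (let S = \<Union> (pverts ` cycle_subgraphs G)
            in \<lparr>pverts = S, parcs = {(u, v) \<in> parcs G. u \<in> S \<and> v \<in> S}\<rparr>)"

lemma with_proj_Cyc:
  "with_proj (Cyc G) = induce_subgraph (with_proj G) (\<Union> (pverts ` cycle_subgraphs G))"
  by (auto simp: Cyc_def Let_def induce_subgraph_def with_proj_def)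

definition For :: "'a pair_pre_digraph \<Rightarrow> 'a pair_pre_digraph" where
  "For G = del_edges G (edges (Cyc G))"

definition two_switch :: "'a pair_pre_digraph \<Rightarrow> 'a \<Rightarrow> 'a \<Rightarrow> 'a \<Rightarrow> 'a \<Rightarrow> bool" where
  "two_switch G a b c d \<longleftrightarrow> distinct [a, b, c, d] \<and>
    {a, b} \<in> edges G \<and> {c, d} \<in> edges G \<and> {a, c} \<notin> edges G \<and> {b, d} \<notin> edges G"

definition apply_switch ::
    "'a \<Rightarrow> 'a \<Rightarrow> 'a \<Rightarrow> 'a \<Rightarrow> 'a pair_pre_digraph \<Rightarrow> 'a pair_pre_digraph" where
  "apply_switch a b c d G = add_edges (del_edges G {{a, b}, {c, d}}) {{a, c}, {b, d}}"

lemma pair_graph_apply_switch: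
  assumes "pair_graph G" "two_switch G a b c d"
  shows "pair_graph (apply_switch a b c d G)"
proof -
  interpret pair_graph G by fact
  have V: "a \<in> pverts G" "b \<in> pverts G" "c \<in> pverts G" "d \<in> pverts G"
    using assms(2) by (auto simp: two_switch_def edges_def doubleton_eq_iff dest: wellformed')
  have fin: "finite (parcs (apply_switch a b c d G))"
    by (rule finite_subset[of _ "parcs G \<union> {a, b, c, d} \<times> {a, b, c, d}"])
      (auto simp: apply_switch_def add_edges_def del_edges_def doubleton_eq_iff)
  show ?thesis
    using assms(2) V pair_finite_verts fin pair_sym_arcs
    by unfold_locales
      (auto simp: apply_switch_def add_edges_def del_edges_def two_switch_def
        doubleton_eq_iff symmetric_def sym_def insert_commute dest: wellformed' no_loops)
qed

definition t_switch :: "'a pair_pre_digraph \<Rightarrow> 'a \<Rightarrow> 'a \<Rightarrow> 'a \<Rightarrow> 'a \<Rightarrow> bool" where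
  "t_switch T a b c d \<longleftrightarrow>
    undirected_tree T \<and> two_switch T a b c d \<and> undirected_tree (apply_switch a b c d T)"

end

theory Submission
  imports Defs
begin

text \<open>
  A connected graph is a tree iff it has one edge less than it has vertices, and it has exactly one
  cycle iff these numbers agree. A 2-switch changes neither, so \<open>\<tau>(U)\<close> is unicyclic iff it is
  connected, and a 2-switch on a tree is a t-switch iff its result is connected.
  In case (1) the cycle survives, and deleting one of its edges does not affect connectedness.
  In case (2) the rest of the cycle still joins \<open>a\<close> to \<open>b\<close> in \<open>\<tau>(U)\<close>; together with the new edges
  it joins \<open>c\<close> to \<open>d\<close>, so nothing gets disconnected. In case (3) the two removed edges cut the
  cycle into a path \<open>P\<close> starting at \<open>b\<close> and a path \<open>Q\<close> ending at \<open>a\<close>. If \<open>P\<close> ends at \<open>c\<close>, the switch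
  merely reverses \<open>P\<close> inside the cycle. If \<open>P\<close> ends at \<open>d\<close>, the new edges join vertices that \<open>P\<close> and
  \<open>Q\<close> already join, so connectedness of \<open>\<tau>(U)\<close> would give connectedness of \<open>U - ab - cd\<close>, which has
  too few edges. Conversely, if \<open>\<tau>(Cyc(U))\<close> is isomorphic to the cycle, it joins \<open>a\<close> to \<open>b\<close>, and
  one concludes as in case (2).
\<close>

subsection \<open>Deleting edges\<close>

lemma pverts_del_edges [simp]: "pverts (del_edges G F) = pverts G"
  by (simp add: del_edges_def)

lemma in_parcs_del_edges_iff [simp]:
  "(u, v) \<in> parcs (del_edges G F) \<longleftrightarrow> (u, v) \<in> parcs G \<and> {u, v} \<notin> F"
  by (simp add: del_edges_def)

lemma edges_del_edges [simp]: "edges (del_edges G F) = edges G - F"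
  by (auto simp: edges_def del_edges_def)

lemma (in pair_sym_digraph) doubleton_in_edges_iff [simp]: "{u, v} \<in> edges G \<longleftrightarrow> (u, v) \<in> parcs G"
proof -
  have "{u, v} \<in> edges G \<longleftrightarrow> (u, v) \<in> parcs G \<or> (v, u) \<in> parcs G"
    by (force simp: edges_def doubleton_eq_iff)
  then show ?thesis using arcs_symmetric by blast
qed

lemma edgesE:
  assumes "e \<in> edges G"
  obtains u v where "e = {u, v}" "(u, v) \<in> parcs G"
  using assms by (auto simp: edges_def)

lemma (in pair_graph) finite_edges: "finite (edges G)"
  using pair_finite_arcs by (simp add: edges_def)

lemma (in pair_graph) card_edges_del_edge:
  "(x, y) \<in> parcs G \<Longrightarrow> Suc (card (edges (del_edges G {{x, y}}))) = card (edges G)"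
  using finite_edges by (simp add: card_Suc_Diff1 del: card_Diff_insert)

lemma (in pair_graph) pair_graph_del_edges: "pair_graph (del_edges G F)"
proof
  show "finite (parcs (del_edges G F))"
    by (rule finite_subset[OF _ pair_finite_arcs]) (auto simp: del_edges_def)
qed (auto simp: del_edges_def symmetric_def sym_def insert_commute
    dest: in_arcsD1 in_arcsD2 no_loops' arcs_symmetric)


subsection \<open>Reachability\<close>

lemma (in pair_wf_digraph) reachable_if_arcs_reachable:
  fixes H :: "'a pair_pre_digraph"
  assumes "u \<rightarrow>\<^sup>*\<^bsub>H\<^esub> v" "pverts H \<subseteq> pverts G"
    and "\<And>x y. (x, y) \<in> parcs H \<Longrightarrow> x \<rightarrow>\<^sup>*\<^bsub>G\<^esub> y"
  shows "u \<rightarrow>\<^sup>*\<^bsub>G\<^esub> v"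
proof -
  have "(u, v) \<in> rtrancl_on (pverts H) (parcs H)"
    using assms(1) by (simp add: reachable_def)
  then show ?thesis
  proof (induction rule: rtrancl_on_induct)
    case base
    then show ?case using assms(2) by blast
  next
    case (step y z)
    then show ?case using assms(3) reachable_trans by blast
  qed
qed

lemma (in pair_wf_digraph) reachable_mono_arcs:
  fixes H :: "'a pair_pre_digraph"
  assumes "u \<rightarrow>\<^sup>*\<^bsub>H\<^esub> v" "pverts H \<subseteq> pverts G" "parcs H \<subseteq> parcs G"
  shows "u \<rightarrow>\<^sup>*\<^bsub>G\<^esub> v"
  using assms rtrancl_on_mono by (simp add: reachable_def)

lemma (in pair_sym_digraph) reachable_sym: "u \<rightarrow>\<^sup>*\<^bsub>G\<^esub> v \<Longrightarrow> v \<rightarrow>\<^sup>*\<^bsub>G\<^esub> u"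
  by (rule symmetric_reachable[OF pair_sym_arcs])

lemma (in pair_sym_digraph) connected_iff_reachable:
  "connected G \<longleftrightarrow> pverts G \<noteq> {} \<and> (\<forall>u \<in> pverts G. \<forall>v \<in> pverts G. u \<rightarrow>\<^sup>*\<^bsub>G\<^esub> v)"
  by (simp add: connected_def strongly_connected_def reachable_mk_symmetric_eq[OF pair_sym_arcs])

lemma (in pair_sym_digraph) connected_if_arcs_reachable:
  fixes H :: "'a pair_pre_digraph"
  assumes "pair_sym_digraph H" "connected H" "pverts H = pverts G"
    and "\<And>x y. (x, y) \<in> parcs H \<Longrightarrow> x \<rightarrow>\<^sup>*\<^bsub>G\<^esub> y"
  shows "connected G"
proof -
  have "u \<rightarrow>\<^sup>*\<^bsub>G\<^esub> v" if "u \<rightarrow>\<^sup>*\<^bsub>H\<^esub> v" for u v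
    using that assms(3,4) reachable_if_arcs_reachable by simp
  then show ?thesis
    using assms(2,3)
    by (simp add: connected_iff_reachable pair_sym_digraph.connected_iff_reachable[OF assms(1)])
qed


subsection \<open>Cycle graphs\<close>

definition cycle_graph :: "'a list \<Rightarrow> 'a pair_pre_digraph" where
  "cycle_graph xs = walk_subgraph (vwalk_arcs (xs @ [hd xs]))"

lemma parcs_cycle_graph:
  assumes "xs \<noteq> []"
  shows "parcs (cycle_graph xs) =
    (let A = insert (last xs, hd xs) (set (vwalk_arcs xs)) in A \<union> A\<inverse>)"
  using assms by (simp add: cycle_graph_def walk_subgraph_def set_vwalk_arcs_snoc Let_def)

lemma fst_snd_vwalk_arcs:
  "2 \<le> length ys \<Longrightarrow> fst ` set (vwalk_arcs ys) \<union> snd ` set (vwalk_arcs ys) = set ys"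
proof (induction ys rule: vwalk_arcs.induct)
  case (3 x y ys)
  then show ?case by (cases ys) auto
qed auto

lemma pverts_cycle_graph [simp]: "pverts (cycle_graph xs) = set xs"
  by (cases "xs = []") (auto simp: cycle_graph_def walk_subgraph_def fst_snd_vwalk_arcs Suc_le_eq)

lemma sym_parcs_walk_subgraph: "sym (parcs (walk_subgraph p))"
  by (auto simp: walk_subgraph_def sym_def)

lemma cycle_graph_append_commute: "cycle_graph (xs @ ys) = cycle_graph (ys @ xs)"
proof (cases "xs = [] \<or> ys = []")
  case False
  then show ?thesis
    by (intro pair_pre_digraph.equality) (auto simp: parcs_cycle_graph Let_def vwalk_arcs_append)
qed auto

lemma cycle_graph_rev: "cycle_graph (rev xs) = cycle_graph xs"
proof (cases "xs = []")
  case False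
  then show ?thesis
    by (intro pair_pre_digraph.equality)
      (auto simp: parcs_cycle_graph Let_def set_vwalk_arcs_rev hd_rev last_rev)
qed simp

lemma distinct_vwalk_arcs_neq:
  assumes "distinct xs" "(x, y) \<in> set (vwalk_arcs xs)"
  shows "x \<noteq> y"
  using assms by (induction xs rule: vwalk_arcs.induct) auto

lemma pair_graph_cycle_graph:
  assumes "distinct xs" "2 \<le> length xs"
  shows "pair_graph (cycle_graph xs)"
proof -
  have "xs \<noteq> []" using assms by auto
  have "last xs \<noteq> hd xs" using assms by (cases xs) auto
  then have "x \<noteq> y" if "(x, y) \<in> parcs (cycle_graph xs)" for x y
    using that distinct_vwalk_arcs_neq[OF assms(1)] \<open>xs \<noteq> []\<close>
    by (auto simp: parcs_cycle_graph Let_def)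
  moreover have "finite (parcs (cycle_graph xs))"
    by (simp add: cycle_graph_def walk_subgraph_def)
  moreover have "sym (parcs (cycle_graph xs))"
    by (simp add: cycle_graph_def sym_parcs_walk_subgraph)
  moreover have "x \<in> set xs \<and> y \<in> set xs" if "(x, y) \<in> parcs (cycle_graph xs)" for x y
    using that \<open>xs \<noteq> []\<close> arcs_in_vwalk_arcs[of _ xs]
    by (auto simp: parcs_cycle_graph Let_def)
  ultimately show ?thesis
    by unfold_locales (auto simp: symmetric_def)
qed

lemma pcas_vwalk_arcs: "ys \<noteq> [] \<Longrightarrow> pcas (hd ys) (vwalk_arcs ys) (last ys)"
  by (induction ys rule: vwalk_arcs.induct) auto

lemma pawalk_verts_vwalk_arcs: "ys \<noteq> [] \<Longrightarrow> pawalk_verts (hd ys) (vwalk_arcs ys) = ys"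
  by (induction ys rule: vwalk_arcs.induct) auto

lemma pawalk_verts_eq_map_fst: "pcas u p v \<Longrightarrow> pawalk_verts u p = map fst p @ [v]"
  by (induction p arbitrary: u) auto

lemma vwalk_arcs_pawalk_verts: "pcas u p v \<Longrightarrow> vwalk_arcs (pawalk_verts u p) = p"
proof (induction p arbitrary: u)
  case (Cons e p)
  then show ?case by (cases p) (auto simp: pawalk_verts_eq_map_fst)
qed simp

lemma walk_subgraph_closed:
  assumes "pcas u p u" "p \<noteq> []"
  shows "walk_subgraph p = cycle_graph (map fst p)"
proof -
  have "hd (map fst p) = u" using assms by (cases p) auto
  then have "p = vwalk_arcs (map fst p @ [hd (map fst p)])"
    using vwalk_arcs_pawalk_verts[OF assms(1)] by (simp add: pawalk_verts_eq_map_fst[OF assms(1)])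
  then show ?thesis by (simp add: cycle_graph_def)
qed

lemma distinct_tl_snoc_hd: "distinct (tl (xs @ [hd xs])) \<longleftrightarrow> distinct xs"
  by (cases xs) auto

lemma (in pair_graph) cycle_vwalk_arcs:
  assumes "distinct xs" "xs \<noteq> []" "parcs (cycle_graph xs) \<subseteq> parcs G"
  shows "cycle (vwalk_arcs (xs @ [hd xs]))"
proof -
  let ?ys = "xs @ [hd xs]"
  have hd: "hd ?ys = hd xs" using assms(2) by simp
  have "set (vwalk_arcs ?ys) \<subseteq> parcs G"
    using assms(3) by (auto simp: cycle_graph_def walk_subgraph_def)
  moreover have "hd xs \<in> pverts G"
    using assms(2,3) by (auto simp: parcs_cycle_graph Let_def intro: in_arcsD2)
  ultimately have "awalk (hd xs) (vwalk_arcs ?ys) (hd xs)"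
    using pcas_vwalk_arcs[of ?ys] by (simp add: awalk_def hd)
  moreover have "distinct (tl (pawalk_verts (hd xs) (vwalk_arcs ?ys)))"
    using pawalk_verts_vwalk_arcs[of ?ys] assms(1) by (simp add: hd distinct_tl_snoc_hd)
  moreover have "vwalk_arcs ?ys \<noteq> []"
    using assms(2) by (simp add: vwalk_arcs_append)
  ultimately show ?thesis by (auto simp: cycle_def)
qed

lemma (in pair_graph) cycle_subgraphs_eq:
  "cycle_subgraphs G =
    {cycle_graph xs | xs. distinct xs \<and> 3 \<le> length xs \<and> parcs (cycle_graph xs) \<subseteq> parcs G}"
    (is "_ = ?R")
proof (intro equalityI subsetI)
  fix C assume "C \<in> cycle_subgraphs G"
  then obtain u p where p: "awalk u p u" "distinct (tl (pawalk_verts u p))" "p \<noteq> []" "3 \<le> length p"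
    and C: "C = walk_subgraph p"
    by (auto simp: cycle_subgraphs_def cycle_def)
  have closed: "pcas u p u" using p(1) by (simp add: awalk_def)
  then have "distinct (map fst p)"
    using p(2,3) by (cases p) (force simp: pawalk_verts_eq_map_fst)+
  moreover have "parcs C \<subseteq> parcs G"
    using p(1) by (auto simp: C walk_subgraph_def awalk_def intro: arcs_symmetric)
  moreover have "C = cycle_graph (map fst p)"
    using walk_subgraph_closed[OF closed p(3)] by (simp add: C)
  ultimately show "C \<in> ?R"
    using p(4) by auto
next
  fix C assume "C \<in> ?R"
  then obtain xs where xs: "distinct xs" "3 \<le> length xs" "parcs (cycle_graph xs) \<subseteq> parcs G"
    and C: "C = cycle_graph xs"
    by blast
  then have "cycle (vwalk_arcs (xs @ [hd xs]))"
    by (intro cycle_vwalk_arcs) auto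
  moreover have "length (vwalk_arcs (xs @ [hd xs])) = length xs"
    by (simp flip: vwalk_length_def)
  ultimately show "C \<in> cycle_subgraphs G"
    using xs(2) unfolding cycle_subgraphs_def C cycle_graph_def by auto
qed

lemma (in pair_graph) cycle_subgraphE:
  assumes "C \<in> cycle_subgraphs G"
  obtains xs where "C = cycle_graph xs" "distinct xs" "3 \<le> length xs"
    "parcs (cycle_graph xs) \<subseteq> parcs G"
  using assms unfolding cycle_subgraphs_eq by blast

lemma (in pair_graph) pair_graph_cycle_subgraph:
  assumes "C \<in> cycle_subgraphs G"
  shows "pair_graph C"
proof -
  from assms obtain xs where "C = cycle_graph xs" "distinct xs" "3 \<le> length xs"
    by (rule cycle_subgraphE)
  then show ?thesis using pair_graph_cycle_graph[of xs] by simp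
qed

lemma (in pair_graph) parcs_cycle_subgraph_subset: "C \<in> cycle_subgraphs G \<Longrightarrow> parcs C \<subseteq> parcs G"
  by (auto elim: cycle_subgraphE)

lemma (in pair_graph) cycle_subgraph_if_parcs_subset:
  assumes "pair_graph H" "C \<in> cycle_subgraphs H" "parcs C \<subseteq> parcs G"
  shows "C \<in> cycle_subgraphs G"
  using assms(3) pair_graph.cycle_subgraphE[OF assms(1,2)] by (auto simp: cycle_subgraphs_eq)

lemma pverts_cycle_subgraph:
  assumes "C \<in> cycle_subgraphs G"
  shows "pverts C = fst ` parcs C"
  using assms by (force simp: cycle_subgraphs_def walk_subgraph_def)

lemma (in pair_graph) pverts_cycle_subgraph_subset:
  "C \<in> cycle_subgraphs G \<Longrightarrow> pverts C \<subseteq> pverts G"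
  using parcs_cycle_subgraph_subset in_arcsD1 by (fastforce simp: pverts_cycle_subgraph)

lemma cycle_subgraph_eqI:
  assumes "C \<in> cycle_subgraphs G" "D \<in> cycle_subgraphs H" "parcs C = parcs D"
  shows "C = D"
  using assms by (intro pair_pre_digraph.equality) (simp_all add: pverts_cycle_subgraph)

lemma (in pair_graph) connected_cycle_subgraph:
  assumes "C \<in> cycle_subgraphs G"
  shows "connected C"
proof -
  from assms obtain xs where xs: "C = cycle_graph xs" "distinct xs" "3 \<le> length xs"
    by (rule cycle_subgraphE)
  interpret C: pair_graph C using assms by (rule pair_graph_cycle_subgraph)
  have "xs \<noteq> []" using xs(3) by auto
  then have "vwalk xs C"
    using xs by (auto simp: parcs_cycle_graph Let_def)
  have "hd xs \<rightarrow>\<^sup>*\<^bsub>C\<^esub> w" if w: "w \<in> set xs" for w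
  proof -
    obtain ys zs where "xs = (ys @ [w]) @ zs" using split_list[OF w] by auto
    then have "vwalk (ys @ [w]) C" "hd (ys @ [w]) = hd xs"
      using vwalkI_append_l[of "ys @ [w]" zs] \<open>vwalk xs C\<close> by (auto simp: hd_append)
    then show ?thesis using C.reachable_vwalk_conv by force
  qed
  then show ?thesis
    using \<open>xs \<noteq> []\<close> C.reachable_sym C.reachable_trans unfolding C.connected_iff_reachable
    by (metis pverts_cycle_graph set_empty xs(1))
qed

lemma in_vwalk_arcs_split:
  "(x, y) \<in> set (vwalk_arcs xs) \<Longrightarrow> \<exists>as bs. xs = as @ x # y # bs"
proof (induction xs rule: vwalk_arcs.induct)
  case (3 u v xs)
  show ?case
  proof (cases "(x, y) = (u, v)")
    case True
    then show ?thesis by (metis append_Nil prod.inject)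
  next
    case False
    then have "\<exists>as bs. v # xs = as @ x # y # bs" using 3 by auto
    then show ?thesis by (metis append_Cons)
  qed
qed auto

lemma cycle_graph_rotate_to_arc:
  assumes "distinct xs" "(x, y) \<in> insert (last xs, hd xs) (set (vwalk_arcs xs))"
  shows "\<exists>zs. distinct zs \<and> length zs = length xs \<and> hd zs = y \<and> last zs = x \<and>
    cycle_graph zs = cycle_graph xs"
proof (cases "(x, y) \<in> set (vwalk_arcs xs)")
  case True
  then obtain as bs where xs: "xs = as @ x # y # bs" using in_vwalk_arcs_split by fast
  have "cycle_graph (y # bs @ as @ [x]) = cycle_graph xs"
    using cycle_graph_append_commute[of "y # bs" "as @ [x]"] by (simp add: xs)
  then show ?thesis
    using assms(1) by (intro exI[of _ "y # bs @ as @ [x]"]) (auto simp: xs)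
next
  case False
  then show ?thesis using assms by (intro exI[of _ xs]) simp
qed

lemma cycle_graph_open_at_arc:
  assumes "distinct xs" "(x, y) \<in> parcs (cycle_graph xs)"
  shows "\<exists>zs. distinct zs \<and> length zs = length xs \<and> hd zs = y \<and> last zs = x \<and>
    cycle_graph zs = cycle_graph xs"
proof -
  have "xs \<noteq> []" using assms(2) by (auto simp: cycle_graph_def walk_subgraph_def)
  with assms(2) consider
      (along) "(x, y) \<in> insert (last xs, hd xs) (set (vwalk_arcs xs))"
    | (against) "(x, y) \<in> insert (last (rev xs), hd (rev xs)) (set (vwalk_arcs (rev xs)))"
    by (auto simp: parcs_cycle_graph Let_def set_vwalk_arcs_rev hd_rev last_rev)
  then show ?thesis
  proof cases
    case along
    with assms(1) show ?thesis by (rule cycle_graph_rotate_to_arc)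
  next
    case against
    then show ?thesis
      using cycle_graph_rotate_to_arc[of "rev xs"] assms(1) by (simp add: cycle_graph_rev)
  qed
qed

lemma closing_arc_notin_vwalk_arcs:
  assumes "distinct xs" "3 \<le> length xs"
  shows "(last xs, hd xs) \<notin> set (vwalk_arcs xs)" "(hd xs, last xs) \<notin> set (vwalk_arcs xs)"
proof -
  obtain y ys where xs: "xs = y # ys" using assms(2) by (cases xs) auto
  then obtain zs x where ys: "ys = zs @ [x]" using assms(2) by (cases ys rule: rev_cases) auto
  then have "zs \<noteq> []" using assms(2) xs by auto
  then show "(last xs, hd xs) \<notin> set (vwalk_arcs xs)" "(hd xs, last xs) \<notin> set (vwalk_arcs xs)"
    using assms(1) arcs_in_vwalk_arcs[of _ zs] by (auto simp: xs ys set_vwalk_arcs_snoc)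
qed

lemma (in pair_graph) cycle_subgraph_open_at_arcE:
  assumes "C \<in> cycle_subgraphs G" "(x, y) \<in> parcs C"
  obtains zs where "C = cycle_graph zs" "distinct zs" "3 \<le> length zs" "hd zs = y" "last zs = x"
proof -
  from assms(1) obtain xs where "C = cycle_graph xs" "distinct xs" "3 \<le> length xs"
    by (rule cycle_subgraphE)
  then show ?thesis using cycle_graph_open_at_arc[of xs x y] assms(2) that by metis
qed

lemma (in pair_graph) cycle_edge_bypass:
  assumes C: "C \<in> cycle_subgraphs G" and xy: "(x, y) \<in> parcs C"
  shows "x \<rightarrow>\<^sup>*\<^bsub>del_edges C {{x, y}}\<^esub> y"
proof -
  interpret C: pair_graph C using C by (rule pair_graph_cycle_subgraph)
  interpret D: pair_graph "del_edges C {{x, y}}" by (rule C.pair_graph_del_edges)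
  from C xy obtain zs where zs: "C = cycle_graph zs" "distinct zs" "3 \<le> length zs"
    "hd zs = y" "last zs = x"
    by (rule cycle_subgraph_open_at_arcE)
  have "zs \<noteq> []" using zs(3) by auto
  then have "vwalk zs (del_edges C {{x, y}})"
    using zs closing_arc_notin_vwalk_arcs[OF zs(2,3)]
    by (auto simp: parcs_cycle_graph Let_def doubleton_eq_iff)
  then have "y \<rightarrow>\<^sup>*\<^bsub>del_edges C {{x, y}}\<^esub> x"
    using zs(4,5) by (auto simp: D.reachable_vwalk_conv)
  then show ?thesis by (rule D.reachable_sym)
qed

lemma (in pair_graph) cycle_through_edge:
  assumes xy: "(x, y) \<in> parcs G" and reach: "x \<rightarrow>\<^sup>*\<^bsub>del_edges G {{x, y}}\<^esub> y"
  shows "\<exists>C \<in> cycle_subgraphs G. (x, y) \<in> parcs C"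
proof -
  interpret D: pair_graph "del_edges G {{x, y}}" by (rule pair_graph_del_edges)
  from reach obtain zs where "vpath zs (del_edges G {{x, y}})"
    and ends: "hd zs = x" "last zs = y"
    by (auto simp: D.reachable_vpath_conv)
  then have zs: "zs \<noteq> []" "distinct zs" "set (vwalk_arcs zs) \<subseteq> parcs (del_edges G {{x, y}})"
    by (auto simp: vpath_def vwalk_def)
  have "3 \<le> length zs"
  proof (rule ccontr)
    assume "\<not> 3 \<le> length zs"
    then consider "zs = [x]" "x = y" | "zs = [x, y]"
      using zs(1) ends by (cases zs; cases "tl zs"; cases "tl (tl zs)") auto
    then show False using zs(3) no_loops'[OF xy] by cases auto
  qed
  moreover have "parcs (cycle_graph zs) \<subseteq> parcs G"
    using zs ends xy arcs_symmetric by (auto simp: parcs_cycle_graph Let_def)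
  moreover have "(x, y) \<in> parcs (cycle_graph zs)"
    using zs(1) ends by (simp add: parcs_cycle_graph Let_def)
  ultimately show ?thesis using zs(2) by (auto simp: cycle_subgraphs_eq)
qed

lemma (in pair_graph) edge_on_cycle_iff:
  assumes "(x, y) \<in> parcs G"
  shows "(\<exists>C \<in> cycle_subgraphs G. (x, y) \<in> parcs C) \<longleftrightarrow> x \<rightarrow>\<^sup>*\<^bsub>del_edges G {{x, y}}\<^esub> y"
proof
  interpret D: pair_graph "del_edges G {{x, y}}" by (rule pair_graph_del_edges)
  assume "\<exists>C \<in> cycle_subgraphs G. (x, y) \<in> parcs C"
  then obtain C where C: "C \<in> cycle_subgraphs G" "(x, y) \<in> parcs C" by blast
  from cycle_edge_bypass[OF C] show "x \<rightarrow>\<^sup>*\<^bsub>del_edges G {{x, y}}\<^esub> y"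
    by (rule D.reachable_mono_arcs)
      (use parcs_cycle_subgraph_subset[OF C(1)] pverts_cycle_subgraph_subset[OF C(1)] in auto)
qed (use assms cycle_through_edge in blast)


subsection \<open>Connected components\<close>

(* Graphs are symmetric digraphs here, so strong connectedness is connectedness. *)
definition num_components :: "'a pair_pre_digraph \<Rightarrow> nat" where
  "num_components G = card (pre_digraph.sccs_verts (with_proj G))"

lemma (in pair_sym_digraph) scc_of_eq_reachable: "scc_of u = {v. u \<rightarrow>\<^sup>*\<^bsub>G\<^esub> v}"
  using reachable_sym by (auto simp: scc_of_def)

lemma (in pair_graph) connected_iff_num_components: "connected G \<longleftrightarrow> num_components G = 1"
proof
  assume "connected G"
  then have nonempty: "pverts G \<noteq> {}"
    and reach: "\<And>u v. u \<in> pverts G \<Longrightarrow> v \<in> pverts G \<Longrightarrow> u \<rightarrow>\<^sup>*\<^bsub>G\<^esub> v"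
    by (simp_all add: connected_iff_reachable)
  have "scc_of u = pverts G" if "u \<in> pverts G" for u
    using that by (auto simp: scc_of_eq_reachable reach dest: reachable_in_verts(2))
  then have "sccs_verts = {pverts G}"
    using nonempty by (auto simp: sccs_verts_conv_scc_of)
  then show "num_components G = 1" by (simp add: num_components_def)
next
  assume "num_components G = 1"
  then obtain S where S: "scc_of ` pverts G = {S}"
    by (auto simp: num_components_def sccs_verts_conv_scc_of card_1_singleton_iff)
  then have "pverts G \<noteq> {}" by auto
  moreover have "u \<rightarrow>\<^sup>*\<^bsub>G\<^esub> v" if "u \<in> pverts G" "v \<in> pverts G" for u v
  proof -
    have "scc_of u = scc_of v" using S that by blast
    then show ?thesis using in_scc_of_self[OF that(2)] by (auto simp: scc_of_eq_reachable)
  qed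
  ultimately show "connected G" by (simp add: connected_iff_reachable)
qed

lemma (in pair_graph) reachable_iff_del_edge:
  assumes "(x, y) \<in> parcs G"
  shows "u \<rightarrow>\<^sup>*\<^bsub>G\<^esub> v \<longleftrightarrow>
    u \<rightarrow>\<^sup>*\<^bsub>del_edges G {{x, y}}\<^esub> v \<or>
    u \<rightarrow>\<^sup>*\<^bsub>del_edges G {{x, y}}\<^esub> x \<and> y \<rightarrow>\<^sup>*\<^bsub>del_edges G {{x, y}}\<^esub> v \<or>
    u \<rightarrow>\<^sup>*\<^bsub>del_edges G {{x, y}}\<^esub> y \<and> x \<rightarrow>\<^sup>*\<^bsub>del_edges G {{x, y}}\<^esub> v"
    (is "_ \<longleftrightarrow> ?avoid u v")
proof
  interpret D: pair_graph "del_edges G {{x, y}}" by (rule pair_graph_del_edges)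
  assume "u \<rightarrow>\<^sup>*\<^bsub>G\<^esub> v"
  then show "?avoid u v"
  proof (induction rule: reachable_induct)
    case base
    then show ?case by simp
  next
    case (step w v)
    show ?case
    proof (cases "{w, v} = {x, y}")
      case True
      then show ?thesis using step D.reachable_refl assms in_arcsD1 in_arcsD2
        by (auto simp: doubleton_eq_iff)
    next
      case False
      then have "w \<rightarrow>\<^bsub>del_edges G {{x, y}}\<^esub> v" using step by simp
      then have "s \<rightarrow>\<^sup>*\<^bsub>del_edges G {{x, y}}\<^esub> v" if "s \<rightarrow>\<^sup>*\<^bsub>del_edges G {{x, y}}\<^esub> w" for s
        using that D.reachable_adj_trans by simp
      then show ?thesis using step.IH by blast
    qed
  qed
next
  have del: "s \<rightarrow>\<^sup>*\<^bsub>G\<^esub> t" if "s \<rightarrow>\<^sup>*\<^bsub>del_edges G {{x, y}}\<^esub> t" for s t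
    using that by (rule reachable_mono_arcs) auto
  assume "?avoid u v"
  then show "u \<rightarrow>\<^sup>*\<^bsub>G\<^esub> v"
    using assms arcs_symmetric[OF assms] by (meson del reachable_adjI reachable_trans)
qed

lemma (in pair_graph) num_components_del_non_bridge:
  assumes "(x, y) \<in> parcs G" "x \<rightarrow>\<^sup>*\<^bsub>del_edges G {{x, y}}\<^esub> y"
  shows "num_components (del_edges G {{x, y}}) = num_components G"
proof -
  let ?D = "del_edges G {{x, y}}"
  interpret D: pair_graph ?D by (rule pair_graph_del_edges)
  have "u \<rightarrow>\<^sup>*\<^bsub>G\<^esub> v \<longleftrightarrow> u \<rightarrow>\<^sup>*\<^bsub>?D\<^esub> v" for u v
    unfolding reachable_iff_del_edge[OF assms(1)]
    using assms(2) D.reachable_sym D.reachable_trans by blast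
  then show ?thesis
    by (simp add: num_components_def sccs_verts_conv_scc_of D.sccs_verts_conv_scc_of
        scc_of_eq_reachable D.scc_of_eq_reachable)
qed

lemma (in pair_graph) scc_of_del_edge_outside:
  assumes "(x, y) \<in> parcs G" "\<not> u \<rightarrow>\<^sup>*\<^bsub>del_edges G {{x, y}}\<^esub> x"
  shows "pre_digraph.scc_of (del_edges G {{x, y}}) u =
    scc_of u - pre_digraph.scc_of (del_edges G {{x, y}}) x"
proof (rule set_eqI)
  fix v
  let ?D = "del_edges G {{x, y}}"
  interpret D: pair_graph ?D by (rule pair_graph_del_edges)
  have "\<not> x \<rightarrow>\<^sup>*\<^bsub>?D\<^esub> v" if "u \<rightarrow>\<^sup>*\<^bsub>?D\<^esub> v"
    using that assms(2) D.reachable_sym D.reachable_trans by blast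
  then show "v \<in> D.scc_of u \<longleftrightarrow> v \<in> scc_of u - D.scc_of x"
    using assms(2) reachable_iff_del_edge[OF assms(1), of u v]
    by (auto simp: scc_of_eq_reachable D.scc_of_eq_reachable)
qed

lemma (in pair_graph) num_components_del_bridge:
  assumes "(x, y) \<in> parcs G" "\<not> x \<rightarrow>\<^sup>*\<^bsub>del_edges G {{x, y}}\<^esub> y"
  shows "num_components (del_edges G {{x, y}}) = Suc (num_components G)"
proof -
  let ?D = "del_edges G {{x, y}}"
  interpret D: pair_graph ?D by (rule pair_graph_del_edges)
  let ?X = "D.scc_of x" and ?V = "pverts G - D.scc_of x"
  have in_X: "u \<in> ?X \<longleftrightarrow> u \<rightarrow>\<^sup>*\<^bsub>?D\<^esub> x" for u
    using D.reachable_sym by (auto simp: D.scc_of_eq_reachable)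
  have y: "y \<in> ?V"
    using assms in_arcsD2 by (auto simp: D.scc_of_eq_reachable)
  have inside: "scc_of u = scc_of y" if "u \<in> ?X" for u
  proof (rule scc_of_eq)
    show "u \<in> scc_of y"
      using that y
      by (simp add: scc_of_eq_reachable D.scc_of_eq_reachable reachable_iff_del_edge[OF assms(1)])
  qed
  (* K \<mapsto> K - X maps the components of G bijectively to those of G - xy other than X. *)
  have "sccs_verts = scc_of ` ?V"
    using y inside by (auto simp: sccs_verts_conv_scc_of)
  moreover have "inj_on (\<lambda>K. K - ?X) (scc_of ` ?V)"
  proof (rule inj_onI, clarify)
    fix u v assume "u \<in> pverts G" "u \<notin> ?X" "scc_of u - ?X = scc_of v - ?X"
    then show "scc_of u = scc_of v"
      using in_scc_of_self scc_of_eq by blast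
  qed
  moreover have "(\<lambda>K. K - ?X) ` scc_of ` ?V = D.scc_of ` ?V"
    using scc_of_del_edge_outside[OF assms(1)] in_X by (simp add: image_image)
  ultimately have "num_components G = card (D.scc_of ` ?V)"
    by (simp add: num_components_def card_image[symmetric])
  moreover have "D.sccs_verts = insert ?X (D.scc_of ` ?V)"
    using in_arcsD1[OF assms(1)] D.scc_of_eq by (auto simp: D.sccs_verts_conv_scc_of)
  moreover have "?X \<notin> D.scc_of ` ?V"
    using D.in_scc_of_self by auto
  ultimately show ?thesis
    using pair_finite_verts by (simp add: num_components_def)
qed


subsection \<open>Counting edges\<close>

lemma pair_graph_del_edge_induct [consumes 1, case_names no_edges edge]:
  assumes "pair_graph G"
    and "\<And>G. pair_graph G \<Longrightarrow> parcs G = {} \<Longrightarrow> P G"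
    and "\<And>G x y. pair_graph G \<Longrightarrow> (x, y) \<in> parcs G \<Longrightarrow> P (del_edges G {{x, y}}) \<Longrightarrow> P G"
  shows "P G"
  using assms(1)
proof (induction "card (edges G)" arbitrary: G rule: less_induct)
  case less
  then interpret pair_graph G by simp
  show ?case
  proof (cases "parcs G = {}")
    case False
    then obtain x y where xy: "(x, y) \<in> parcs G" by auto
    then show ?thesis
      using card_edges_del_edge[OF xy] less.hyps pair_graph_del_edges assms(3)[OF less.prems]
      by simp
  qed (rule assms(2)[OF less.prems])
qed

lemma (in pair_graph) num_components_no_edges:
  assumes "parcs G = {}"
  shows "num_components G = card (pverts G)"
proof -
  have "scc_of u = {u}" if "u \<in> pverts G" for u
    using that assms by (auto simp: scc_of_eq_reachable elim: converse_reachable_cases)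
  then have "inj_on scc_of (pverts G)" by (simp add: inj_on_def)
  then show ?thesis by (simp add: num_components_def sccs_verts_conv_scc_of card_image)
qed

lemma card_pverts_le_components_plus_edges:
  assumes "pair_graph G"
  shows "card (pverts G) \<le> num_components G + card (edges G)"
  using assms
proof (induction rule: pair_graph_del_edge_induct)
  case (no_edges G)
  then show ?case by (simp add: pair_graph.num_components_no_edges)
next
  case (edge G x y)
  then interpret pair_graph G by simp
  have "num_components (del_edges G {{x, y}}) \<le> Suc (num_components G)"
    using num_components_del_non_bridge num_components_del_bridge edge.hyps(2)
    by (cases "x \<rightarrow>\<^sup>*\<^bsub>del_edges G {{x, y}}\<^esub> y") simp_all
  then show ?case
    using edge.IH card_edges_del_edge[OF edge.hyps(2)] by simp
qed

lemma card_pverts_acyclic: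
  assumes "pair_graph G" "cycle_subgraphs G = {}"
  shows "card (pverts G) = num_components G + card (edges G)"
  using assms
proof (induction rule: pair_graph_del_edge_induct)
  case (no_edges G)
  then show ?case by (simp add: pair_graph.num_components_no_edges edges_def)
next
  case (edge G x y)
  then interpret pair_graph G by simp
  interpret D: pair_graph "del_edges G {{x, y}}" by (rule pair_graph_del_edges)
  have "cycle_subgraphs (del_edges G {{x, y}}) = {}"
    using edge.prems cycle_subgraph_if_parcs_subset[OF D.pair_graph] D.parcs_cycle_subgraph_subset
    by fastforce
  moreover have "num_components (del_edges G {{x, y}}) = Suc (num_components G)"
    using edge num_components_del_bridge edge_on_cycle_iff by blast
  ultimately show ?case
    using edge.IH card_edges_del_edge[OF edge.hyps(2)] by simp
qed

lemma (in pair_graph) num_components_del_cycle_edge: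
  assumes "C \<in> cycle_subgraphs G" "(x, y) \<in> parcs C"
  shows "num_components (del_edges G {{x, y}}) = num_components G"
  using assms parcs_cycle_subgraph_subset edge_on_cycle_iff num_components_del_non_bridge by blast

lemma (in pair_graph) connected_del_cycle_edge_iff:
  assumes "C \<in> cycle_subgraphs G" "(x, y) \<in> parcs C"
  shows "connected (del_edges G {{x, y}}) \<longleftrightarrow> connected G"
  using num_components_del_cycle_edge[OF assms]
  by (simp add: connected_iff_num_components
      pair_graph.connected_iff_num_components[OF pair_graph_del_edges])

lemma (in pair_graph) cycle_subgraph_arcE:
  assumes "C \<in> cycle_subgraphs G"
  obtains x y where "(x, y) \<in> parcs C"
proof -
  from assms obtain xs where "C = cycle_graph xs" "3 \<le> length xs" by (rule cycle_subgraphE)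
  then have "(last xs, hd xs) \<in> parcs C" by (cases "xs = []") (auto simp: parcs_cycle_graph Let_def)
  then show ?thesis by (rule that)
qed

lemma (in pair_graph) acyclic_iff_card_pverts:
  "cycle_subgraphs G = {} \<longleftrightarrow> card (pverts G) = num_components G + card (edges G)"
proof
  assume card: "card (pverts G) = num_components G + card (edges G)"
  have False if C: "C \<in> cycle_subgraphs G" for C
  proof -
    obtain x y where xy: "(x, y) \<in> parcs C" using C by (rule cycle_subgraph_arcE)
    then have "(x, y) \<in> parcs G" using parcs_cycle_subgraph_subset[OF C] by blast
    then show False
      using card card_pverts_le_components_plus_edges[OF pair_graph_del_edges, of "{{x, y}}"]
        num_components_del_cycle_edge[OF C xy] card_edges_del_edge[of x y] by simp
  qed
  then show "cycle_subgraphs G = {}" by blast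
qed (rule card_pverts_acyclic[OF pair_graph])

lemma (in pair_graph) connected_card_pverts_le:
  "connected G \<Longrightarrow> card (pverts G) \<le> Suc (card (edges G))"
  using card_pverts_le_components_plus_edges[OF pair_graph]
  by (simp add: connected_iff_num_components)

lemma (in pair_graph) undirected_tree_iff_card:
  "undirected_tree G \<longleftrightarrow> connected G \<and> card (pverts G) = Suc (card (edges G))"
  using pair_graph
  by (auto simp: undirected_tree_def acyclic_iff_card_pverts connected_iff_num_components)

lemma (in pair_graph) undirected_tree_del_cycle_edge:
  assumes "connected G" "card (pverts G) = card (edges G)"
    and C: "C \<in> cycle_subgraphs G" "(x, y) \<in> parcs C"
  shows "undirected_tree (del_edges G {{x, y}})"
proof -
  have "(x, y) \<in> parcs G" using C parcs_cycle_subgraph_subset by blast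
  then show ?thesis
    using assms connected_del_cycle_edge_iff[OF C] card_edges_del_edge[of x y]
    by (simp add: pair_graph.undirected_tree_iff_card[OF pair_graph_del_edges])
qed

lemma (in pair_graph) card_pverts_unicyclic:
  assumes "unicyclic G"
  shows "card (pverts G) = card (edges G)"
proof -
  obtain C where C: "C \<in> cycle_subgraphs G" and unique: "\<And>D. D \<in> cycle_subgraphs G \<Longrightarrow> D = C"
    using assms by (auto simp: unicyclic_def)
  obtain x y where xy: "(x, y) \<in> parcs C" using C by (rule cycle_subgraph_arcE)
  let ?T = "del_edges G {{x, y}}"
  interpret T: pair_graph ?T by (rule pair_graph_del_edges)
  have "D \<notin> cycle_subgraphs ?T" for D
  proof
    assume D: "D \<in> cycle_subgraphs ?T"
    note T.parcs_cycle_subgraph_subset[OF D]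
    moreover from this have "D \<in> cycle_subgraphs G"
      by (intro cycle_subgraph_if_parcs_subset[OF T.pair_graph D]) auto
    ultimately show False using unique xy by auto
  qed
  then have "undirected_tree ?T"
    using assms T.pair_graph connected_del_cycle_edge_iff[OF C xy]
    by (auto simp: undirected_tree_def unicyclic_def)
  then show ?thesis
    using card_edges_del_edge[of x y] parcs_cycle_subgraph_subset[OF C] xy
    by (auto simp: T.undirected_tree_iff_card)
qed

lemma (in pair_graph) unicyclic_if_card:
  assumes G: "connected G" "card (pverts G) = card (edges G)"
  shows "unicyclic G"
proof -
  have "cycle_subgraphs G \<noteq> {}"
    using G by (auto simp: acyclic_iff_card_pverts connected_iff_num_components)
  then obtain C where C: "C \<in> cycle_subgraphs G" by blast
  (* Deleting an edge of D that is missing from E would leave a tree containing the cycle E. *)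
  have sub: "parcs D \<subseteq> parcs E" if D: "D \<in> cycle_subgraphs G" and E: "E \<in> cycle_subgraphs G" for D E
  proof (rule subrelI, rule ccontr)
    interpret E: pair_graph E using E by (rule pair_graph_cycle_subgraph)
    fix u v assume uv: "(u, v) \<in> parcs D" "(u, v) \<notin> parcs E"
    have "undirected_tree (del_edges G {{u, v}})"
      using G D uv(1) by (rule undirected_tree_del_cycle_edge)
    moreover have "parcs E \<subseteq> parcs (del_edges G {{u, v}})"
      using parcs_cycle_subgraph_subset[OF E] uv(2) E.arcs_symmetric
      by (auto simp: doubleton_eq_iff)
    then have "E \<in> cycle_subgraphs (del_edges G {{u, v}})"
      by (rule pair_graph.cycle_subgraph_if_parcs_subset[OF pair_graph_del_edges pair_graph E])
    ultimately show False by (simp add: undirected_tree_def)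
  qed
  have "D = C" if D: "D \<in> cycle_subgraphs G" for D
    using cycle_subgraph_eqI[OF D C] sub[OF D C] sub[OF C D] by simp
  then show ?thesis using G(1) C pair_graph by (auto simp: unicyclic_def)
qed

lemma (in pair_graph) unicyclic_iff_card:
  "unicyclic G \<longleftrightarrow> connected G \<and> card (pverts G) = card (edges G)"
  using card_pverts_unicyclic unicyclic_if_card by (auto simp: unicyclic_def)


subsection \<open>The cycle of a unicyclic graph\<close>

lemma (in pair_graph) unicyclic_cycle_chordless:
  assumes "unicyclic G" and C: "C \<in> cycle_subgraphs G"
    and uv: "(u, v) \<in> parcs G" "u \<in> pverts C" "v \<in> pverts C"
  shows "(u, v) \<in> parcs C"
proof (rule ccontr)
  assume chord: "(u, v) \<notin> parcs C"
  interpret C: pair_graph C using C by (rule pair_graph_cycle_subgraph)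
  interpret D: pair_graph "del_edges G {{u, v}}" by (rule pair_graph_del_edges)
  have "u \<rightarrow>\<^sup>*\<^bsub>C\<^esub> v"
    using connected_cycle_subgraph[OF C] uv(2,3) by (simp add: C.connected_iff_reachable)
  then have "u \<rightarrow>\<^sup>*\<^bsub>del_edges G {{u, v}}\<^esub> v"
  proof (rule D.reachable_mono_arcs)
    show "pverts C \<subseteq> pverts (del_edges G {{u, v}})"
      using pverts_cycle_subgraph_subset[OF C] by simp
    show "parcs C \<subseteq> parcs (del_edges G {{u, v}})"
      using parcs_cycle_subgraph_subset[OF C] chord C.arcs_symmetric
      by (auto simp: doubleton_eq_iff)
  qed
  then obtain E where "E \<in> cycle_subgraphs G" "(u, v) \<in> parcs E"
    using edge_on_cycle_iff[OF uv(1)] by blast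
  then show False
    using assms(1) C chord by (auto simp: unicyclic_def)
qed

lemma cycle_subgraphs_unicyclic:
  assumes "unicyclic U"
  shows "cycle_subgraphs U = {Cyc U}"
proof -
  interpret pair_graph U using assms by (simp add: unicyclic_def)
  obtain C where C: "cycle_subgraphs U = {C}" using assms by (auto simp: unicyclic_def)
  then have C_in: "C \<in> cycle_subgraphs U" by simp
  then interpret C: pair_graph C by (rule pair_graph_cycle_subgraph)
  have "Cyc U = C"
    using C parcs_cycle_subgraph_subset[OF C_in] unicyclic_cycle_chordless[OF assms C_in]
      C.in_arcsD1 C.in_arcsD2
    by (intro pair_pre_digraph.equality) (auto simp: Cyc_def Let_def)
  then show ?thesis using C by simp
qed

lemma Cyc_in_cycle_subgraphs: "unicyclic U \<Longrightarrow> Cyc U \<in> cycle_subgraphs U"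
  using cycle_subgraphs_unicyclic by blast

lemma edges_Cyc_nonempty:
  assumes "unicyclic U"
  shows "edges (Cyc U) \<noteq> {}"
proof -
  interpret pair_graph U using assms by (simp add: unicyclic_def)
  obtain x y where "(x, y) \<in> parcs (Cyc U)"
    using Cyc_in_cycle_subgraphs[OF assms] by (rule cycle_subgraph_arcE)
  then show ?thesis by (auto simp: edges_def)
qed

lemma edges_For_disjoint: "e \<in> edges (For G) \<Longrightarrow> e \<notin> edges (Cyc G)"
  by (simp add: For_def)


subsection \<open>Two-switches\<close>

lemma pverts_apply_switch [simp]: "pverts (apply_switch a b c d G) = pverts G"
  by (simp add: apply_switch_def add_edges_def)

lemma in_parcs_apply_switch_iff:
  "(u, v) \<in> parcs (apply_switch a b c d G) \<longleftrightarrow>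
    (u, v) \<in> parcs G \<and> {u, v} \<notin> {{a, b}, {c, d}} \<or> {u, v} \<in> {{a, c}, {b, d}}"
  by (simp add: apply_switch_def add_edges_def)

lemma edges_apply_switch:
  "edges (apply_switch a b c d G) = edges G - {{a, b}, {c, d}} \<union> {{a, c}, {b, d}}"
proof -
  have "parcs (apply_switch a b c d G) =
      parcs (del_edges G {{a, b}, {c, d}}) \<union> {(a, c), (c, a), (b, d), (d, b)}"
    by (auto simp: apply_switch_def add_edges_def doubleton_eq_iff)
  then have "edges (apply_switch a b c d G) =
      edges (del_edges G {{a, b}, {c, d}}) \<union> {{a, c}, {b, d}}"
    by (simp add: edges_def image_Un insert_commute)
  then show ?thesis by simp
qed

lemma parcs_subset_apply_switch:
  assumes "parcs H \<subseteq> parcs G" "edges H \<inter> {{a, b}, {c, d}} = {}"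
  shows "parcs H \<subseteq> parcs (apply_switch a b c d G)"
proof (rule subrelI)
  fix u v assume uv: "(u, v) \<in> parcs H"
  then have "{u, v} \<in> edges H" by (force simp: edges_def)
  then show "(u, v) \<in> parcs (apply_switch a b c d G)"
    using assms uv unfolding in_parcs_apply_switch_iff by blast
qed

lemma apply_switch_commute: "apply_switch c d a b G = apply_switch a b c d G"
  by (simp add: apply_switch_def insert_commute)

lemma two_switch_commute: "two_switch G c d a b \<longleftrightarrow> two_switch G a b c d"
  by (auto simp: two_switch_def insert_commute)

lemma del_edges_del_edges: "del_edges (del_edges G E) F = del_edges G (E \<union> F)"
  by (intro pair_pre_digraph.equality) (auto simp: del_edges_def)

lemma del_edges_add_edges:
  "E \<inter> F = {} \<Longrightarrow> del_edges (add_edges G E) F = add_edges (del_edges G F) E"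
  by (intro pair_pre_digraph.equality) (auto simp: del_edges_def add_edges_def)

lemma del_edges_apply_switch:
  assumes "{{a, c}, {b, d}} \<inter> F = {}"
  shows "del_edges (apply_switch a b c d G) F = apply_switch a b c d (del_edges G F)"
  unfolding apply_switch_def del_edges_add_edges[OF assms]
  by (simp only: del_edges_del_edges Un_commute)

lemma (in pair_graph) card_edges_del_switched:
  assumes "two_switch G a b c d"
  shows "card (edges (del_edges G {{a, b}, {c, d}})) + 2 = card (edges G)"
proof -
  have "card {{a, b}, {c, d}} = 2"
    using assms by (auto simp: two_switch_def doubleton_eq_iff)
  moreover have "{{a, b}, {c, d}} \<subseteq> edges G"
    using assms by (auto simp: two_switch_def)
  ultimately show ?thesis
    using card_Diff_subset[of "{{a, b}, {c, d}}" "edges G"]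
      card_mono[OF finite_edges, of "{{a, b}, {c, d}}"] by simp
qed

lemma (in pair_graph) card_edges_apply_switch:
  assumes "two_switch G a b c d"
  shows "card (edges (apply_switch a b c d G)) = card (edges G)"
proof -
  have "{a, c} \<noteq> {b, d}" "{a, c} \<notin> edges G" "{b, d} \<notin> edges G"
    using assms by (auto simp: two_switch_def doubleton_eq_iff)
  then have "card (edges (apply_switch a b c d G)) = card (edges G - {{a, b}, {c, d}}) + 2"
    using finite_edges by (simp add: edges_apply_switch del: doubleton_in_edges_iff)
  then show ?thesis using card_edges_del_switched[OF assms] by simp
qed

lemma undirected_tree_apply_switch_iff:
  assumes "undirected_tree T" "two_switch T a b c d"
  shows "undirected_tree (apply_switch a b c d T) \<longleftrightarrow> connected (apply_switch a b c d T)"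
proof -
  interpret pair_graph T using assms(1) by (simp add: undirected_tree_def)
  interpret S: pair_graph "apply_switch a b c d T"
    using pair_graph assms(2) by (rule pair_graph_apply_switch)
  show ?thesis
    using assms(1) card_edges_apply_switch[OF assms(2)]
    by (simp add: undirected_tree_iff_card S.undirected_tree_iff_card)
qed

lemma unicyclic_apply_switch_iff:
  assumes "unicyclic U" "two_switch U a b c d"
  shows "unicyclic (apply_switch a b c d U) \<longleftrightarrow> connected (apply_switch a b c d U)"
proof -
  interpret pair_graph U using assms(1) by (simp add: unicyclic_def)
  interpret S: pair_graph "apply_switch a b c d U"
    using pair_graph assms(2) by (rule pair_graph_apply_switch)
  show ?thesis
    using assms(1) card_edges_apply_switch[OF assms(2)]
    by (simp add: unicyclic_iff_card S.unicyclic_iff_card)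
qed

lemma (in pair_graph) connected_apply_switch_if_reachable:
  assumes "connected G" "two_switch G a b c d" "a \<rightarrow>\<^sup>*\<^bsub>apply_switch a b c d G\<^esub> b"
  shows "connected (apply_switch a b c d G)"
proof -
  let ?S = "apply_switch a b c d G"
  interpret S: pair_graph ?S using pair_graph assms(2) by (rule pair_graph_apply_switch)
  have "c \<rightarrow>\<^sup>*\<^bsub>?S\<^esub> a" "b \<rightarrow>\<^sup>*\<^bsub>?S\<^esub> d"
    by (auto intro!: S.reachable_adjI simp: in_parcs_apply_switch_iff)
  then have cd: "c \<rightarrow>\<^sup>*\<^bsub>?S\<^esub> d"
    using assms(3) S.reachable_trans by blast
  have "x \<rightarrow>\<^sup>*\<^bsub>?S\<^esub> y" if "(x, y) \<in> parcs G" for x y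
  proof (cases "{x, y} \<in> {{a, b}, {c, d}}")
    case True
    then show ?thesis
      using assms(3) cd S.reachable_sym[OF assms(3)] S.reachable_sym[OF cd]
      by (auto simp: doubleton_eq_iff)
  next
    case False
    then have "(x, y) \<in> parcs ?S" using that by (auto simp: in_parcs_apply_switch_iff)
    then show ?thesis by (rule S.reachable_adjI)
  qed
  then show ?thesis
    using S.connected_if_arcs_reachable[OF pair_sym_digraph_axioms assms(1)] by simp
qed

lemma (in pair_graph) not_connected_apply_switch_if_reachable:
  assumes "unicyclic G" "two_switch G a b c d"
    and ac: "a \<rightarrow>\<^sup>*\<^bsub>del_edges G {{a, b}, {c, d}}\<^esub> c"
    and bd: "b \<rightarrow>\<^sup>*\<^bsub>del_edges G {{a, b}, {c, d}}\<^esub> d"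
  shows "\<not> connected (apply_switch a b c d G)"
proof
  let ?D = "del_edges G {{a, b}, {c, d}}" and ?S = "apply_switch a b c d G"
  interpret D: pair_graph ?D by (rule pair_graph_del_edges)
  interpret S: pair_graph ?S using pair_graph assms(2) by (rule pair_graph_apply_switch)
  assume "connected ?S"
  moreover have "x \<rightarrow>\<^sup>*\<^bsub>?D\<^esub> y" if "(x, y) \<in> parcs ?S" for x y
    using that ac bd D.reachable_sym[OF ac] D.reachable_sym[OF bd]
    by (auto simp: in_parcs_apply_switch_iff doubleton_eq_iff)
  ultimately have "connected ?D"
    using D.connected_if_arcs_reachable[OF S.pair_sym_digraph_axioms] by simp
  then have "card (edges G) \<le> Suc (card (edges ?D))"
    using D.connected_card_pverts_le assms(1) by (simp add: unicyclic_iff_card)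
  then show False using card_edges_del_switched[OF assms(2)] by simp
qed

lemma t_switch_del_cycle_edge_iff:
  assumes U: "unicyclic U" and switch: "two_switch U a b c d"
    and off: "{a, b} \<notin> edges (Cyc U)" "{c, d} \<notin> edges (Cyc U)" and e: "e \<in> edges (Cyc U)"
  shows "t_switch (del_edges U {e}) a b c d \<longleftrightarrow> unicyclic (apply_switch a b c d U)"
proof -
  let ?S = "apply_switch a b c d U"
  interpret pair_graph U using U by (simp add: unicyclic_def)
  interpret S: pair_graph ?S using pair_graph switch by (rule pair_graph_apply_switch)
  have C: "Cyc U \<in> cycle_subgraphs U" by (rule Cyc_in_cycle_subgraphs[OF U])
  obtain x y where xy: "e = {x, y}" "(x, y) \<in> parcs (Cyc U)" using e by (rule edgesE)
  have tree: "undirected_tree (del_edges U {e})"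
    using U C xy undirected_tree_del_cycle_edge unicyclic_iff_card by blast
  have "e \<in> edges U" using xy parcs_cycle_subgraph_subset[OF C] by auto
  then have commute: "del_edges ?S {e} = apply_switch a b c d (del_edges U {e})"
    using switch by (intro del_edges_apply_switch) (auto simp: two_switch_def)
  have switch_e: "two_switch (del_edges U {e}) a b c d"
    using switch off e by (auto simp: two_switch_def)
  have "Cyc U \<in> cycle_subgraphs ?S"
    using pair_graph C
  proof (rule S.cycle_subgraph_if_parcs_subset)
    show "parcs (Cyc U) \<subseteq> parcs ?S"
      using parcs_cycle_subgraph_subset[OF C] off by (intro parcs_subset_apply_switch) auto
  qed
  then have "connected (del_edges ?S {e}) \<longleftrightarrow> connected ?S"
    using S.connected_del_cycle_edge_iff xy by simp
  then show ?thesis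
    using undirected_tree_apply_switch_iff[OF tree switch_e] unicyclic_apply_switch_iff[OF U switch]
      tree switch_e by (simp add: t_switch_def flip: commute)
qed

lemma unicyclic_apply_switch_off_cycle_iff:
  assumes U: "unicyclic U" and switch: "two_switch U a b c d"
    and off: "{a, b} \<notin> edges (Cyc U)" "{c, d} \<notin> edges (Cyc U)"
  shows "unicyclic (apply_switch a b c d U) \<longleftrightarrow>
    (\<forall>e \<in> edges (Cyc U). t_switch (del_edges U {e}) a b c d)"
  using edges_Cyc_nonempty[OF U] t_switch_del_cycle_edge_iff[OF U switch off] by blast

lemma unicyclic_apply_switch_if_one_on_cycle:
  assumes U: "unicyclic U" and switch: "two_switch U a b c d"
    and ab: "{a, b} \<in> edges (Cyc U)" and cd: "{c, d} \<notin> edges (Cyc U)"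
  shows "unicyclic (apply_switch a b c d U)"
proof -
  let ?S = "apply_switch a b c d U"
  interpret pair_graph U using U by (simp add: unicyclic_def)
  interpret S: pair_graph ?S using pair_graph switch by (rule pair_graph_apply_switch)
  have C: "Cyc U \<in> cycle_subgraphs U" by (rule Cyc_in_cycle_subgraphs[OF U])
  interpret C: pair_graph "Cyc U" using C by (rule pair_graph_cycle_subgraph)
  have "a \<rightarrow>\<^sup>*\<^bsub>del_edges (Cyc U) {{a, b}}\<^esub> b"
    using ab by (intro cycle_edge_bypass[OF C]) simp
  then have "a \<rightarrow>\<^sup>*\<^bsub>?S\<^esub> b"
  proof (rule S.reachable_mono_arcs)
    show "pverts (del_edges (Cyc U) {{a, b}}) \<subseteq> pverts ?S"
      using pverts_cycle_subgraph_subset[OF C] by simp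
    show "parcs (del_edges (Cyc U) {{a, b}}) \<subseteq> parcs ?S"
      using parcs_cycle_subgraph_subset[OF C] cd by (intro parcs_subset_apply_switch) auto
  qed
  then show ?thesis
    using U connected_apply_switch_if_reachable[OF _ switch]
    by (simp add: unicyclic_apply_switch_iff[OF U switch] unicyclic_iff_card)
qed


subsection \<open>Isomorphisms\<close>

lemma (in pair_wf_digraph) digraph_iso_image:
  assumes "inj_on f (pverts G)"
  shows "digraph_iso G (with_proj \<lparr>pverts = f ` pverts G, parcs = map_prod f f ` parcs G\<rparr>)"
    (is "digraph_iso _ ?H")
proof -
  define h where "h = \<lparr>iso_verts = f, iso_arcs = map_prod f f, iso_head = snd, iso_tail = fst\<rparr>"
  have "parcs G \<subseteq> pverts G \<times> pverts G" using in_arcsD1 in_arcsD2 by auto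
  then have "inj_on (map_prod f f) (parcs G)"
    using assms map_prod_inj_on inj_on_subset by blast
  then have "digraph_isomorphism h"
    using assms wf_digraph_axioms by (simp add: digraph_isomorphism_def h_def)
  moreover have "?H = app_iso h G"
    by (simp add: app_iso_def h_def with_proj_def)
  ultimately show ?thesis unfolding digraph_iso_def by blast
qed

lemma vwalk_arcs_map: "vwalk_arcs (map f xs) = map (map_prod f f) (vwalk_arcs xs)"
  by (induction xs rule: vwalk_arcs.induct) auto

lemma cycle_graph_map:
  assumes "xs \<noteq> []"
  shows "cycle_graph (map f xs) =
    \<lparr>pverts = f ` set xs, parcs = map_prod f f ` parcs (cycle_graph xs)\<rparr>"
proof -
  have "map f xs @ [hd (map f xs)] = map f (xs @ [hd xs])"
    using assms by (simp add: hd_map)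
  then have "vwalk_arcs (map f xs @ [hd (map f xs)]) =
      map (map_prod f f) (vwalk_arcs (xs @ [hd xs]))"
    by (simp only: vwalk_arcs_map)
  moreover have "(map_prod f f ` R)\<inverse> = map_prod f f ` R\<inverse>" for R
    by (auto intro!: rev_image_eqI)
  ultimately have "parcs (cycle_graph (map f xs)) = map_prod f f ` parcs (cycle_graph xs)"
    by (simp add: cycle_graph_def walk_subgraph_def image_Un)
  then show ?thesis by (intro pair_pre_digraph.equality) simp_all
qed

lemma digraph_iso_cycle_graph:
  assumes "distinct xs" "distinct ys" "length xs = length ys" "2 \<le> length xs"
  shows "digraph_iso (cycle_graph xs) (cycle_graph ys)"
proof -
  define f where "f = (\<lambda>x. the (map_of (zip xs ys) x))"
  have map_f: "map f xs = ys"
    using assms by (intro nth_equalityI) (auto simp: f_def map_of_zip_nth)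
  then have "inj_on f (pverts (cycle_graph xs))"
    using assms(2) by (auto simp: distinct_map)
  moreover interpret pair_graph "cycle_graph xs"
    using assms by (intro pair_graph_cycle_graph)
  have "xs \<noteq> []" using assms(4) by auto
  ultimately show ?thesis
    using digraph_iso_image[of f] cycle_graph_map[of xs f] map_f by simp
qed

lemma (in wf_digraph) connected_if_digraph_iso:
  assumes "digraph_iso G H" "connected G"
  shows "connected H"
  using assms connectedI_app_iso by (auto simp: digraph_iso_def)


subsection \<open>Switching two edges of the cycle\<close>

lemma apply_switch_mono:
  assumes "parcs H \<subseteq> parcs G"
  shows "parcs (apply_switch a b c d H) \<subseteq> parcs (apply_switch a b c d G)"
proof (rule subrelI)
  fix u v assume "(u, v) \<in> parcs (apply_switch a b c d H)"
  with assms show "(u, v) \<in> parcs (apply_switch a b c d G)"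
    unfolding in_parcs_apply_switch_iff by blast
qed

lemma apply_switch_cycle_graph:
  assumes "distinct (xs @ ys)" "xs \<noteq> []" "ys \<noteq> []"
  shows "apply_switch (last ys) (hd xs) (last xs) (hd ys) (cycle_graph (xs @ ys)) =
    cycle_graph (rev xs @ ys)"
proof -
  have ends: "hd xs \<in> set xs" "last xs \<in> set xs" "hd ys \<in> set ys" "last ys \<in> set ys"
    using assms by simp_all
  have "{(last ys, hd xs), (hd xs, last ys), (last xs, hd ys), (hd ys, last xs)}
      \<inter> (set (vwalk_arcs xs) \<union> set (vwalk_arcs ys)) = {}"
    using ends assms(1) by (auto dest: arcs_in_vwalk_arcs)
  then show ?thesis
    using assms(2,3)
    by (intro pair_pre_digraph.equality)
      (auto simp: in_parcs_apply_switch_iff parcs_cycle_graph Let_def vwalk_arcs_append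
        set_vwalk_arcs_rev hd_rev last_rev doubleton_eq_iff)
qed

lemma (in pair_graph) cycle_subgraph_splitE:
  assumes C: "C \<in> cycle_subgraphs G" and arcs: "(a, b) \<in> parcs C" "(c, d) \<in> parcs C"
    and dist: "distinct [a, b, c, d]"
  obtains P Q where "C = cycle_graph (P @ Q)" "distinct (P @ Q)" "P \<noteq> []" "Q \<noteq> []"
    "vwalk P G" "vwalk Q G"
    "hd P = b" "last Q = a" "last P = c \<and> hd Q = d \<or> last P = d \<and> hd Q = c"
proof -
  from C arcs(1) obtain zs where zs: "C = cycle_graph zs" "distinct zs" "3 \<le> length zs"
    "hd zs = b" "last zs = a"
    by (rule cycle_subgraph_open_at_arcE)
  have "zs \<noteq> []" using zs(3) by auto
  then have "(c, d) \<in> set (vwalk_arcs zs) \<or> (d, c) \<in> set (vwalk_arcs zs)"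
    using arcs(2) dist zs(1,4,5) by (auto simp: parcs_cycle_graph Let_def)
  then obtain x y where xy: "(x, y) \<in> set (vwalk_arcs zs)" "x = c \<and> y = d \<or> x = d \<and> y = c"
    by blast
  then obtain as bs where split: "zs = (as @ [x]) @ (y # bs)"
    using in_vwalk_arcs_split by fastforce
  have "vwalk zs G"
    using parcs_cycle_subgraph_subset[OF C] pverts_cycle_subgraph_subset[OF C] \<open>zs \<noteq> []\<close>
    by (intro vwalkI) (auto simp: zs(1) parcs_cycle_graph Let_def)
  then have walks: "vwalk (as @ [x]) G" "vwalk (y # bs) G"
    using vwalkI_append_l[of "as @ [x]" "y # bs"] vwalkI_append_r[of "y # bs" "as @ [x]"]
    by (simp_all add: split)
  show ?thesis
  proof (rule that[OF _ _ _ _ walks])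
    show "C = cycle_graph ((as @ [x]) @ (y # bs))" "distinct ((as @ [x]) @ (y # bs))"
      using zs split by simp_all
    show "hd (as @ [x]) = b" using zs(4) split by (auto simp: hd_append)
    show "last (y # bs) = a" using zs(5) split by simp
  qed (use xy(2) in auto)
qed

lemma (in pair_graph) vwalk_reachable_del_edges:
  assumes "vwalk p G" "\<And>e. e \<in> F \<Longrightarrow> \<not> e \<subseteq> set p"
  shows "hd p \<rightarrow>\<^sup>*\<^bsub>del_edges G F\<^esub> last p"
proof -
  interpret D: pair_graph "del_edges G F" by (rule pair_graph_del_edges)
  have "{u, v} \<notin> F" if "(u, v) \<in> set (vwalk_arcs p)" for u v
    using that assms(2)[of "{u, v}"] arcs_in_vwalk_arcs[of "(u, v)" p] by auto
  then have "vwalk p (del_edges G F)"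
    using assms(1) by (auto simp: vwalk_def)
  then show ?thesis using D.reachable_vwalk_conv by blast
qed

lemma apply_switch_Cyc_iso_if_connected:
  assumes U: "unicyclic U" and switch: "two_switch U a b c d"
    and ab: "{a, b} \<in> edges (Cyc U)" and cd: "{c, d} \<in> edges (Cyc U)"
    and connected: "connected (apply_switch a b c d U)"
  shows "digraph_iso (apply_switch a b c d (Cyc U)) (Cyc U)"
proof -
  interpret pair_graph U using U by (simp add: unicyclic_def)
  have C: "Cyc U \<in> cycle_subgraphs U" by (rule Cyc_in_cycle_subgraphs[OF U])
  interpret C: pair_graph "Cyc U" using C by (rule pair_graph_cycle_subgraph)
  let ?D = "del_edges U {{a, b}, {c, d}}"
  interpret D: pair_graph ?D by (rule pair_graph_del_edges)
  have dist: "distinct [a, b, c, d]" using switch by (simp add: two_switch_def)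
  obtain P Q where PQ: "Cyc U = cycle_graph (P @ Q)" "distinct (P @ Q)" "P \<noteq> []" "Q \<noteq> []"
    and walks: "vwalk P U" "vwalk Q U"
    and ends: "hd P = b" "last Q = a" "last P = c \<and> hd Q = d \<or> last P = d \<and> hd Q = c"
    using ab cd by (auto intro: cycle_subgraph_splitE[OF C _ _ dist, of thesis])
  have "hd P \<in> set P" "last P \<in> set P" "hd Q \<in> set Q" "last Q \<in> set Q"
    using PQ(3,4) by simp_all
  then have "\<not> {a, b} \<subseteq> set P" "\<not> {a, b} \<subseteq> set Q" "\<not> {c, d} \<subseteq> set P" "\<not> {c, d} \<subseteq> set Q"
    using PQ(2) ends by auto
  then have "\<not> e \<subseteq> set P" "\<not> e \<subseteq> set Q" if "e \<in> {{a, b}, {c, d}}" for e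
    using that by blast+
  then have reach: "b \<rightarrow>\<^sup>*\<^bsub>?D\<^esub> last P" "hd Q \<rightarrow>\<^sup>*\<^bsub>?D\<^esub> a"
    using walks ends vwalk_reachable_del_edges by metis+
  have "\<not> (last P = d \<and> hd Q = c)"
  proof
    assume "last P = d \<and> hd Q = c"
    then have "a \<rightarrow>\<^sup>*\<^bsub>?D\<^esub> c" "b \<rightarrow>\<^sup>*\<^bsub>?D\<^esub> d"
      using reach(1) D.reachable_sym[OF reach(2)] by simp_all
    then show False
      using not_connected_apply_switch_if_reachable[OF U switch] connected by blast
  qed
  then have "last P = c" "hd Q = d" using ends(3) by auto
  then have "apply_switch a b c d (Cyc U) = cycle_graph (rev P @ Q)"
    using apply_switch_cycle_graph[OF PQ(2-4)] ends(1,2) PQ(1) by simp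
  moreover have "2 \<le> length (rev P @ Q)"
    using PQ(3,4) by (cases P; cases Q) auto
  ultimately show ?thesis
    using PQ(1,2) digraph_iso_cycle_graph[of "rev P @ Q" "P @ Q"] by simp
qed

lemma connected_apply_switch_if_Cyc_iso:
  assumes U: "unicyclic U" and switch: "two_switch U a b c d"
    and ab: "{a, b} \<in> edges (Cyc U)" and cd: "{c, d} \<in> edges (Cyc U)"
    and iso: "digraph_iso (apply_switch a b c d (Cyc U)) (Cyc U)"
  shows "connected (apply_switch a b c d U)"
proof -
  let ?S = "apply_switch a b c d U" and ?D = "apply_switch a b c d (Cyc U)"
  interpret pair_graph U using U by (simp add: unicyclic_def)
  interpret S: pair_graph ?S using pair_graph switch by (rule pair_graph_apply_switch)
  have C: "Cyc U \<in> cycle_subgraphs U" by (rule Cyc_in_cycle_subgraphs[OF U])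
  interpret C: pair_graph "Cyc U" using C by (rule pair_graph_cycle_subgraph)
  have C_sub: "parcs (Cyc U) \<subseteq> parcs U" by (rule parcs_cycle_subgraph_subset[OF C])
  have "two_switch (Cyc U) a b c d"
    using switch ab cd C_sub by (auto simp: two_switch_def)
  then interpret D: pair_graph ?D by (rule pair_graph_apply_switch[OF C.pair_graph])
  have "connected ?D"
    using digraph_iso_swap[OF D.wf_digraph_axioms iso] connected_cycle_subgraph[OF C]
    by (rule C.connected_if_digraph_iso)
  then have "a \<rightarrow>\<^sup>*\<^bsub>?D\<^esub> b"
    using ab C.in_arcsD1 C.in_arcsD2 by (simp add: D.connected_iff_reachable)
  then have "a \<rightarrow>\<^sup>*\<^bsub>?S\<^esub> b"
    using C_sub pverts_cycle_subgraph_subset[OF C]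
    by (intro S.reachable_mono_arcs[OF _ _ apply_switch_mono]) auto
  then show ?thesis
    using U connected_apply_switch_if_reachable[OF _ switch] by (simp add: unicyclic_iff_card)
qed

lemma unicyclic_apply_switch_on_cycle_iff:
  assumes U: "unicyclic U" and switch: "two_switch U a b c d"
    and on: "{a, b} \<in> edges (Cyc U)" "{c, d} \<in> edges (Cyc U)"
  shows "unicyclic (apply_switch a b c d U) \<longleftrightarrow>
    digraph_iso (apply_switch a b c d (Cyc U)) (Cyc U)"
  using unicyclic_apply_switch_iff[OF U switch] apply_switch_Cyc_iso_if_connected[OF U switch on]
    connected_apply_switch_if_Cyc_iso[OF U switch on] by blast

theorem mainTheorem4:
  fixes U :: "'a pair_pre_digraph" and a b c d :: 'a and e1 e2 :: "'a set"
  assumes "unicyclic U"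
    and "two_switch U a b c d"
    and "{e1, e2} = {{a, b}, {c, d}}"
  shows "(e1 \<in> edges (For U) \<and> e2 \<in> edges (For U) \<longrightarrow>
           (unicyclic (apply_switch a b c d U) \<longleftrightarrow>
             (\<forall>e \<in> edges (Cyc U). t_switch (del_edges U {e}) a b c d)))
       \<and> (e1 \<in> edges (Cyc U) \<and> e2 \<in> edges (For U) \<longrightarrow>
           unicyclic (apply_switch a b c d U))
       \<and> (e1 \<in> edges (Cyc U) \<and> e2 \<in> edges (Cyc U) \<longrightarrow>
           (unicyclic (apply_switch a b c d U) \<longleftrightarrow>
             digraph_iso (with_proj (apply_switch a b c d (Cyc U))) (with_proj (Cyc U))))"
proof -
  note U = assms(1) and switch = assms(2)
  have ends: "e1 = {a, b} \<and> e2 = {c, d} \<or> e1 = {c, d} \<and> e2 = {a, b}"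
    using assms(3) by (simp add: doubleton_eq_iff)
  have off: "e1 \<in> edges (For U) \<Longrightarrow> e1 \<notin> edges (Cyc U)"
    "e2 \<in> edges (For U) \<Longrightarrow> e2 \<notin> edges (Cyc U)"
    by (simp_all add: edges_For_disjoint)
  have "unicyclic (apply_switch a b c d U)"
    if "{c, d} \<in> edges (Cyc U)" "{a, b} \<notin> edges (Cyc U)"
    using unicyclic_apply_switch_if_one_on_cycle[OF U _ that] switch
    by (simp add: two_switch_commute apply_switch_commute)
  then show ?thesis
    using ends off unicyclic_apply_switch_if_one_on_cycle[OF U switch]
      unicyclic_apply_switch_off_cycle_iff[OF U switch]
      unicyclic_apply_switch_on_cycle_iff[OF U switch] by blast
qed

end
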